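(* Let $\mathcal{X}\subseteq\mathbb{R}^n$ be open and convex, let $\mathcal{U}\subseteq\mathbb{R}^m$ be open, and let $f:\mathcal{X}\times\mathcal{U}\to\mathcal{X}$ be surjective. Consider the discrete-time controlled system $x^+=f(x,u)$. The following two statements are equivalent. 1. (Koopman linear embedding) There exist a positive integer $n_z$, a function $\Psi:\mathcal{X}\to\mathbb{R}^{n_z}$ and constant real matrices $A_K,B_K,C_K$ of compatible dimensions such that for all $x\in\mathcal{X}$, $u\in\mathcal{U}$, $$\Psi(f(x,u))=A_K\Psi(x)+B_Ku,\qquad x=C_K\Psi(x).$$ 2. (CAP structure with Koopman-closed generator) There exists an invertible matrix $T\in\mathbb{R}^{n\times n}$ such that, in the coordinates $\mathrm{col}(x_1,x_2):=Tx$ (for some partition into two consecutive blocks), the dynamics can be written, for all $\mathrm{col}(x_1,x_2)\in T\mathcal{X}$ and $u\in\mathcal{U}$, as $$\begin{bmatrix}x_1^+\\ x_2^+\end{bmatrix}=\begin{bmatrix} g(x_2)+Cx_1\\ h(x_2)\end{bmatrix}+\begin{bmatrix}D\\ 0\end{bmatrix}u$$ for some functions $g,h$ and constant real matrices $C,D$ of compatible dimensions, and there exist a positive integer $\bar n_z$, a function $\bar\Psi:\mathrm{proj}_{x_2}(T\mathcal{X})\to\mathbb{R}^{\bar n_z}$ and constant real matrices $\bar A_K,\bar C_K$ of compatible dimensions such that for all $x_2\in\mathrm{proj}_{x_2}(T\mathcal{X})$, $$\bar\Psi(h(x_2))=\bar A_K\bar\Psi(x_2),\qquad \mathrm{col}(x_2,g(x_2))=\bar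 C_K\bar\Psi(x_2).$$
   Context: $\mathrm{col}(a,b)$ denotes vertical stacking of vectors. $T\mathcal{X}:=\{Tx\mid x\in\mathcal{X}\}$ and $\mathrm{proj}_{x_2}(T\mathcal{X})$ is the set of all $x_2$ such that $\mathrm{col}(x_1,x_2)\in T\mathcal{X}$ for some $x_1$. The blocks satisfy $x_1\in\mathbb{R}^{n_1}$, $x_2\in\mathbb{R}^{n_2}$, $n_1+n_2=n$; either block may be empty: if $n_1=0$ the system is autonomous, and if $n_2=0$ the function $g$ (and $\bar\Psi$) is a constant vector and the system is affine. The functions $g,h$ are defined on $\mathrm{proj}_{x_2}(T\mathcal{X})$. *)

theory Defs
  imports Complex_Main "HOL-Library.FuncSet" "Jordan_Normal_Form.Matrix"
begin

text \<open>
  The Euclidean space of dimension \<open>n\<close> is \<open>carrier_vec n :: real vec set\<close>.  Explicit carriers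
  are used since block sizes and lifted dimensions are quantified inside the statements and
  blocks may be empty.  The type of vectors carries no topology and is not a real vector space
  as a type, so openness (with respect to the Euclidean distance) and convexity of subsets
  are spelled out here.
\<close>

definition open_Rn :: "nat \<Rightarrow> real vec set \<Rightarrow> bool" where
  "open_Rn n X \<longleftrightarrow> X \<subseteq> carrier_vec n \<and>
     (\<forall>x\<in>X. \<exists>e>0. \<forall>y\<in>carrier_vec n. sqrt ((y - x) \<bullet> (y - x)) < e \<longrightarrow> y \<in> X)"

definition convex_Rn :: "nat \<Rightarrow> real vec set \<Rightarrow> bool" where
  "convex_Rn n X \<longleftrightarrow> X \<subseteq> carrier_vec n \<and>
     (\<forall>x\<in>X. \<forall>y\<in>X. \<forall>a\<ge>0. \<forall>b\<ge>0. a + b = 1 \<longrightarrow> a \<cdot>\<^sub>v x + b \<cdot>\<^sub>v y \<in> X)"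

definition mat_image :: "real mat \<Rightarrow> real vec set \<Rightarrow> real vec set" where
  "mat_image T X = {T *\<^sub>v x | x. x \<in> X}"

definition proj_snd :: "nat \<Rightarrow> nat \<Rightarrow> real vec set \<Rightarrow> real vec set" where
  "proj_snd n1 n2 S = {x2 \<in> carrier_vec n2. \<exists>x1\<in>carrier_vec n1. x1 @\<^sub>v x2 \<in> S}"

definition koopman_linear_embedding ::
  "nat \<Rightarrow> nat \<Rightarrow> real vec set \<Rightarrow> real vec set \<Rightarrow> (real vec \<times> real vec \<Rightarrow> real vec) \<Rightarrow> bool" where
  "koopman_linear_embedding n m X U f \<longleftrightarrow>
     (\<exists>nz \<Psi> A B C. nz > 0 \<and> \<Psi> \<in> X \<rightarrow> carrier_vec nz \<and>
        A \<in> carrier_mat nz nz \<and> B \<in> carrier_mat nz m \<and> C \<in> carrier_mat n nz \<and>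
        (\<forall>x\<in>X. \<forall>u\<in>U. \<Psi> (f (x, u)) = A *\<^sub>v \<Psi> x + B *\<^sub>v u \<and> x = C *\<^sub>v \<Psi> x))"

text \<open>The map \<open>f\<close> in the coordinates \<open>T x = x1 @\<^sub>v x2\<close>, with blocks of size \<open>n1\<close> and \<open>n2\<close>.\<close>

definition cap_form ::
  "nat \<Rightarrow> nat \<Rightarrow> nat \<Rightarrow> real vec set \<Rightarrow> real vec set \<Rightarrow> (real vec \<times> real vec \<Rightarrow> real vec) \<Rightarrow>
   real mat \<Rightarrow> (real vec \<Rightarrow> real vec) \<Rightarrow> (real vec \<Rightarrow> real vec) \<Rightarrow> real mat \<Rightarrow> real mat \<Rightarrow> bool" where
  "cap_form n1 n2 m X U f T g h C D \<longleftrightarrow>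
     g \<in> proj_snd n1 n2 (mat_image T X) \<rightarrow> carrier_vec n1 \<and>
     h \<in> proj_snd n1 n2 (mat_image T X) \<rightarrow> carrier_vec n2 \<and>
     C \<in> carrier_mat n1 n1 \<and> D \<in> carrier_mat n1 m \<and>
     (\<forall>x\<in>X. \<forall>u\<in>U. \<forall>x1\<in>carrier_vec n1. \<forall>x2\<in>carrier_vec n2. T *\<^sub>v x = x1 @\<^sub>v x2 \<longrightarrow>
        T *\<^sub>v f (x, u) = ((g x2 + C *\<^sub>v x1) @\<^sub>v h x2) + (D @\<^sub>r 0\<^sub>m n2 m) *\<^sub>v u)"

definition koopman_closed_generator ::
  "nat \<Rightarrow> nat \<Rightarrow> real vec set \<Rightarrow> (real vec \<Rightarrow> real vec) \<Rightarrow> (real vec \<Rightarrow> real vec) \<Rightarrow> bool" where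
  "koopman_closed_generator n1 n2 P g h \<longleftrightarrow>
     (\<exists>nz \<Psi> A C. nz > 0 \<and> \<Psi> \<in> P \<rightarrow> carrier_vec nz \<and>
        A \<in> carrier_mat nz nz \<and> C \<in> carrier_mat (n2 + n1) nz \<and>
        (\<forall>x2\<in>P. \<Psi> (h x2) = A *\<^sub>v \<Psi> x2 \<and> x2 @\<^sub>v g x2 = C *\<^sub>v \<Psi> x2))"

end

theory Submission
  imports Defs "Jordan_Normal_Form.Determinant"
begin

text \<open>
  A direction \<open>w\<close> of the lifted space is affine if \<open>\<Psi> (x + t C w) = \<Psi> x + t w\<close> whenever both points
  lie in \<open>X\<close>.  Since \<open>f\<close> is onto, every point of \<open>X\<close> is some \<open>f (x, u)\<close>; perturbing \<open>u\<close> and \<open>x\<close> there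
  shows, first locally and then globally by convexity, that the affine directions form an
  \<open>A\<close>-invariant subspace \<open>R\<close> containing the range of \<open>B\<close>, on which \<open>C\<close> is injective.  Choose \<open>T\<close>
  so that the first block of coordinates spans \<open>C R\<close>, write \<open>T C\<close> in blocks \<open>C1\<close>, \<open>C2\<close>, and let \<open>L\<close>
  invert \<open>C1\<close> on \<open>R\<close>.  Then \<open>C2\<close> and \<open>N = 1 - L C1\<close> vanish on \<open>R\<close>, so \<open>N \<Psi>\<close> depends on \<open>x2\<close> only and is
  the lifting of the autonomous block, with \<open>g = C1 A N \<Psi>\<close> and \<open>h = C2 A N \<Psi>\<close>.  Conversely,
  \<open>x1\<close> stacked over the lifting of \<open>x2\<close> is a linear embedding.
\<close>

section \<open>Linear algebra\<close>

definition vec_subspace :: "nat \<Rightarrow> real vec set \<Rightarrow> bool" where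
  "vec_subspace n V \<longleftrightarrow> V \<subseteq> carrier_vec n \<and> 0\<^sub>v n \<in> V \<and>
     (\<forall>v\<in>V. \<forall>w\<in>V. v + w \<in> V) \<and> (\<forall>c. \<forall>v\<in>V. c \<cdot>\<^sub>v v \<in> V)"

text \<open>\<open>M *\<^sub>v a\<close> is the combination of the columns of \<open>M\<close> with
  coefficients \<open>a\<close>. Truncating \<open>a\<close> to its first \<open>r\<close> entries
  adds one column per induction step.\<close>

lemma mult_mat_vec_mem_subspace:
  assumes V: "vec_subspace n V" and M: "M \<in> carrier_mat n k"
    and cols: "\<And>j. j < k \<Longrightarrow> col M j \<in> V" and a: "a \<in> carrier_vec k"
  shows "M *\<^sub>v a \<in> V"
proof -
  let ?a = "\<lambda>r. vec k (\<lambda>i. if i < r then a $ i else 0)"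
  have "r \<le> k \<Longrightarrow> M *\<^sub>v ?a r \<in> V" for r
  proof (induction r)
    case 0
    have "?a 0 = 0\<^sub>v k" by auto
    then have "M *\<^sub>v ?a 0 = 0\<^sub>v n" using M by auto
    then show ?case using V by (simp add: vec_subspace_def)
  next
    case (Suc r)
    have "?a (Suc r) = ?a r + a $ r \<cdot>\<^sub>v unit_vec k r"
      using Suc.prems by (intro eq_vecI) (auto simp: less_Suc_eq)
    moreover have "M *\<^sub>v unit_vec k r = col M r"
      using M Suc.prems by (intro eq_vecI) auto
    ultimately have "M *\<^sub>v ?a (Suc r) = M *\<^sub>v ?a r + a $ r \<cdot>\<^sub>v col M r"
      using M by (simp add: mult_add_distrib_mat_vec[OF M] mult_mat_vec[OF M])
    moreover have "a $ r \<cdot>\<^sub>v col M r \<in> V" "M *\<^sub>v ?a r \<in> V"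
      using V cols Suc by (auto simp: vec_subspace_def)
    ultimately show ?case using V by (simp add: vec_subspace_def)
  qed
  from this[of k] have "M *\<^sub>v ?a k \<in> V" by simp
  moreover have "?a k = a" using a by (intro eq_vecI) auto
  ultimately show ?thesis by simp
qed

lemma split_rows:
  assumes M: "(M :: real mat) \<in> carrier_mat (p + q) k"
  obtains M1 M2 where "M1 \<in> carrier_mat p k" "M2 \<in> carrier_mat q k"
    "\<forall>w\<in>carrier_vec k. M *\<^sub>v w = (M1 *\<^sub>v w) @\<^sub>v (M2 *\<^sub>v w)"
proof -
  define M1 where "M1 = mat p k (\<lambda>(i, j). M $$ (i, j))"
  define M2 where "M2 = mat q k (\<lambda>(i, j). M $$ (p + i, j))"
  have M12: "M1 \<in> carrier_mat p k" "M2 \<in> carrier_mat q k" by (auto simp: M1_def M2_def)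
  have "M = M1 @\<^sub>r M2"
    using M by (intro eq_matI) (auto simp: append_rows_def M1_def M2_def)
  then show thesis using that[OF M12] mat_mult_append[OF M12] by simp
qed

lemma zero_mult_mat_vec: "w \<in> carrier_vec k \<Longrightarrow> 0\<^sub>m r k *\<^sub>v w = (0\<^sub>v r :: real vec)"
  by (intro eq_vecI) auto

lemma mult_mat_vec_inverse:
  assumes "M \<in> carrier_mat p q" "M' \<in> carrier_mat q p" "M * M' = 1\<^sub>m p"
    and v: "(v :: real vec) \<in> carrier_vec p"
  shows "M *\<^sub>v (M' *\<^sub>v v) = v"
proof -
  have "M *\<^sub>v (M' *\<^sub>v v) = (M * M') *\<^sub>v v" using assoc_mult_mat_vec[OF assms(1,2) v] by (rule sym)
  then show ?thesis using assms(3) v by simp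
qed

lemma vec_last_append:
  "v \<in> carrier_vec p \<Longrightarrow> w \<in> carrier_vec q \<Longrightarrow> vec_last (v @\<^sub>v w) q = w"
  by (intro eq_vecI) (auto simp: vec_last_def)

section \<open>Coordinates adapted to a subspace\<close>

lemma det_nonzero_inverse:
  assumes S: "(S :: real mat) \<in> carrier_mat n n" and "det S \<noteq> 0"
  obtains T where "T \<in> carrier_mat n n" "T * S = 1\<^sub>m n" "S * T = 1\<^sub>m n"
  using det_non_zero_imp_unit[OF assms, of "()"] unfolding Units_def ring_mat_def by auto

text \<open>Exchange step: if the first \<^term>\<open>k\<close> columns of \<^term>\<open>S\<close> lie in \<^term>\<open>V\<close> but do not span it,
  then a vector of \<^term>\<open>V\<close> outside their span can be made column \<^term>\<open>k\<close>; by Cramer's rule the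
  determinant is only scaled.\<close>

lemma subspace_column_exchange:
  assumes S: "(S :: real mat) \<in> carrier_mat n n" and det: "det S \<noteq> 0"
    and cols: "\<And>j. j < k \<Longrightarrow> col S j \<in> V"
    and y: "y \<in> carrier_vec n" and v: "S *\<^sub>v y \<in> V"
    and p: "k \<le> p" "p < n" "y $ p \<noteq> 0"
  shows "\<exists>S'. S' \<in> carrier_mat n n \<and> det S' \<noteq> 0 \<and> (\<forall>j < Suc k. col S' j \<in> V)"
proof -
  define S1 where "S1 = replace_col S (S *\<^sub>v y) p"
  have S1: "S1 \<in> carrier_mat n n" using S by (simp add: S1_def replace_col_def)
  have det1: "det S1 \<noteq> 0"
    using cramer_lemma_mat[OF S y p(2)] det p(3) by (simp add: S1_def)
  \<comment> \<open>For \<open>p = k\<close> the new column is already in place; otherwise the swap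
    moves it there and only flips the sign of the determinant.\<close>
  define S2 where "S2 = (if k = p then S1 else swapcols k p S1)"
  have S2: "S2 \<in> carrier_mat n n" using S1 by (simp add: S2_def)
  have det2: "det S2 \<noteq> 0"
    using det_swapcols[of k n p S1] det1 p S1 by (simp add: S2_def)
  have "col S2 j \<in> V" if j: "j < Suc k" for j
  proof (cases "j = k")
    case True
    have "col S2 j = S *\<^sub>v y"
      using S S1 p y True by (intro eq_vecI) (auto simp: S2_def S1_def replace_col_def)
    then show ?thesis using v by simp
  next
    \<comment> \<open>Since \<open>k \<le> p\<close>, neither the replacement nor the swap touches
      the columns before \<open>k\<close>.\<close>
    case False
    then have "col S2 j = col S j"
      using S S1 p j by (intro eq_vecI) (auto simp: S2_def S1_def replace_col_def)
    then show ?thesis using cols False j by simp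
  qed
  then show ?thesis using S2 det2 by blast
qed

text \<open>Take an invertible \<open>S\<close> with as many leading columns in \<open>V\<close> as
  possible. By the exchange step, maximality leaves no vector of \<open>V\<close> with a nonzero
  coordinate beyond them. So the first \<open>n1\<close> columns form a basis of \<open>V\<close>,
  completed by the others to a basis of the whole space, and \<open>T\<close> computes the
  coordinates.\<close>

lemma subspace_coordinates:
  assumes V: "vec_subspace n V"
  obtains S T :: "real mat" and n1 n2 where
    "S \<in> carrier_mat n n" "T \<in> carrier_mat n n" "T * S = 1\<^sub>m n" "S * T = 1\<^sub>m n" "n1 + n2 = n"
    "\<forall>j<n1. col S j \<in> V"
    "\<forall>v\<in>V. vec_last (T *\<^sub>v v) n2 = 0\<^sub>v n2"
proof -
  let ?P = "\<lambda>k. k \<le> n \<and> (\<exists>S::real mat. S \<in> carrier_mat n n \<and> det S \<noteq> 0 \<and> (\<forall>j<k. col S j \<in> V))"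
  have "?P 0" by (intro conjI exI[of _ "1\<^sub>m n"]) auto
  moreover have "\<forall>k. ?P k \<longrightarrow> k \<le> n" by blast
  ultimately obtain k where k: "?P k" and max: "\<And>l. ?P l \<Longrightarrow> l \<le> k"
    using GreatestI_nat[of ?P 0 n] Greatest_le_nat[of ?P _ n] by blast
  from k obtain S where S: "S \<in> carrier_mat n n" "det S \<noteq> 0" and cols: "\<And>j. j < k \<Longrightarrow> col S j \<in> V"
    by blast
  obtain T where T: "T \<in> carrier_mat n n" "T * S = 1\<^sub>m n" "S * T = 1\<^sub>m n"
    using det_nonzero_inverse[OF S] .
  have last: "vec_last (T *\<^sub>v v) (n - k) = 0\<^sub>v (n - k)" if v: "v \<in> V" for v
  proof (rule ccontr)
    assume "vec_last (T *\<^sub>v v) (n - k) \<noteq> 0\<^sub>v (n - k)"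
    then obtain i where i: "i < n - k" "vec_last (T *\<^sub>v v) (n - k) $ i \<noteq> 0"
      by (metis carrier_vecD eq_vecI index_zero_vec vec_last_carrier)
    have vc: "v \<in> carrier_vec n" using V v by (auto simp: vec_subspace_def)
    have y: "T *\<^sub>v v \<in> carrier_vec n" using T vc by auto
    have "S *\<^sub>v (T *\<^sub>v v) = v" using mult_mat_vec_inverse[OF S(1) T(1,3) vc] .
    moreover have "(T *\<^sub>v v) $ (k + i) \<noteq> 0" using i k T by (simp add: vec_last_def)
    ultimately have "?P (Suc k)"
      using subspace_column_exchange[OF S cols y, of k "k + i"] v i by auto
    then have "Suc k \<le> k" by (rule max)
    then show False by simp
  qed
  show thesis using that[of S T k "n - k"] S T cols last k by auto
qed

section \<open>Openness and convexity along lines\<close>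

lemma open_Rn_line:
  assumes X: "open_Rn n X" and x: "x \<in> X" and v: "v \<in> carrier_vec n"
  shows "\<exists>e>0. \<forall>s. \<bar>s\<bar> < e \<longrightarrow> x + s \<cdot>\<^sub>v v \<in> X"
proof -
  obtain e where e: "e > 0" "\<And>y. y \<in> carrier_vec n \<Longrightarrow> sqrt ((y - x) \<bullet> (y - x)) < e \<Longrightarrow> y \<in> X"
    using X x by (auto simp: open_Rn_def)
  have xc: "x \<in> carrier_vec n" using X x by (auto simp: open_Rn_def)
  define r where "r = sqrt (v \<bullet> v)"
  have r: "r \<ge> 0" by (simp add: r_def scalar_prod_def sum_nonneg)
  \<comment> \<open>Dividing by \<open>r + 1\<close> instead of \<open>r\<close> covers
    \<open>v = 0\<close>.\<close>
  have "x + s \<cdot>\<^sub>v v \<in> X" if s: "\<bar>s\<bar> < e / (r + 1)" for s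
  proof (rule e(2))
    show "x + s \<cdot>\<^sub>v v \<in> carrier_vec n" using xc v by simp
    have "x + s \<cdot>\<^sub>v v - x = s \<cdot>\<^sub>v v" using xc v by (intro eq_vecI) auto
    moreover have "(s \<cdot>\<^sub>v v) \<bullet> (s \<cdot>\<^sub>v v) = s\<^sup>2 * (v \<bullet> v)"
      using v by (simp add: power2_eq_square)
    ultimately have "sqrt ((x + s \<cdot>\<^sub>v v - x) \<bullet> (x + s \<cdot>\<^sub>v v - x)) = \<bar>s\<bar> * r"
      by (simp add: r_def real_sqrt_mult)
    also have "\<dots> \<le> \<bar>s\<bar> * (r + 1)" by (simp add: algebra_simps)
    also have "\<dots> < e" using s r by (simp add: field_simps)
    finally show "sqrt ((x + s \<cdot>\<^sub>v v - x) \<bullet> (x + s \<cdot>\<^sub>v v - x)) < e" .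
  qed
  moreover have "e / (r + 1) > 0" using e r by simp
  ultimately show ?thesis by blast
qed

text \<open>Convexity keeps the segment from \<open>x\<close> to
  \<open>x + t \<cdot>\<^sub>v v\<close> inside \<open>X\<close>. On the parameter interval from 0
  to 1, the increment formula is additive under concatenation of intervals and holds on short
  intervals around each point, so the Bolzano principle gives it on the whole segment.\<close>

lemma locally_affine_on_line:
  assumes X: "convex_Rn n X" and \<Psi>: "\<Psi> \<in> X \<rightarrow> carrier_vec k"
    and v: "v \<in> carrier_vec n" and w: "w \<in> carrier_vec k"
    and loc: "\<And>x. x \<in> X \<Longrightarrow>
      \<exists>e>0. \<forall>s. \<bar>s\<bar> < e \<longrightarrow> x + s \<cdot>\<^sub>v v \<in> X \<longrightarrow> \<Psi> (x + s \<cdot>\<^sub>v v) = \<Psi> x + s \<cdot>\<^sub>v w"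
    and x: "x \<in> X" and xt: "x + t \<cdot>\<^sub>v v \<in> X"
  shows "\<Psi> (x + t \<cdot>\<^sub>v v) = \<Psi> x + t \<cdot>\<^sub>v w"
proof -
  have xc: "x \<in> carrier_vec n" using X x by (auto simp: convex_Rn_def)
  let ?y = "\<lambda>s. x + (s * t) \<cdot>\<^sub>v v"
  have y: "?y s \<in> X" if "0 \<le> s" "s \<le> 1" for s
  proof -
    have "(1 - s) \<cdot>\<^sub>v x + s \<cdot>\<^sub>v (x + t \<cdot>\<^sub>v v) \<in> X"
      using X x xt that by (auto simp: convex_Rn_def)
    moreover have "(1 - s) \<cdot>\<^sub>v x + s \<cdot>\<^sub>v (x + t \<cdot>\<^sub>v v) = ?y s"
      using xc v by (intro eq_vecI) (auto simp: algebra_simps)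
    ultimately show ?thesis by simp
  qed
  have \<Psi>y: "\<Psi> (?y s) \<in> carrier_vec k" if "0 \<le> s" "s \<le> 1" for s using y[OF that] \<Psi> by auto
  \<comment> \<open>The guard sits inside \<open>P\<close> because the local condition of
    \<open>Bolzano\<close> also ranges over endpoints outside the unit interval, where the point may
    leave \<open>X\<close>.\<close>
  define P where "P a b \<longleftrightarrow> (0 \<le> a \<and> b \<le> 1 \<longrightarrow> \<Psi> (?y b) = \<Psi> (?y a) + ((b - a) * t) \<cdot>\<^sub>v w)" for a b
  have "P 0 1"
  proof (rule Bolzano)
    show "(0::real) \<le> 1" by simp
  next
    fix a b c assume *: "P a b" "P b c" "a \<le> b" "b \<le> c"
    show "P a c" unfolding P_def
    proof (intro impI, elim conjE)
      assume ac: "0 \<le> a" "c \<le> 1"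
      have "\<Psi> (?y c) = \<Psi> (?y a) + ((b - a) * t) \<cdot>\<^sub>v w + ((c - b) * t) \<cdot>\<^sub>v w"
        using * ac by (auto simp: P_def)
      also have "\<dots> = \<Psi> (?y a) + ((c - a) * t) \<cdot>\<^sub>v w"
        using \<Psi>y[of a] ac * w by (intro eq_vecI) (auto simp: algebra_simps)
      finally show "\<Psi> (?y c) = \<Psi> (?y a) + ((c - a) * t) \<cdot>\<^sub>v w" .
    qed
  next
    fix s :: real assume s: "0 \<le> s" "s \<le> 1"
    obtain e where e: "e > 0"
      "\<And>r. \<bar>r\<bar> < e \<Longrightarrow> ?y s + r \<cdot>\<^sub>v v \<in> X \<Longrightarrow> \<Psi> (?y s + r \<cdot>\<^sub>v v) = \<Psi> (?y s) + r \<cdot>\<^sub>v w"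
      using loc[OF y[OF s]] by blast
    have near: "\<Psi> (?y b) = \<Psi> (?y s) + ((b - s) * t) \<cdot>\<^sub>v w"
      if b: "0 \<le> b" "b \<le> 1" "\<bar>b - s\<bar> < e / (\<bar>t\<bar> + 1)" for b
    proof -
      have eq: "?y s + ((b - s) * t) \<cdot>\<^sub>v v = ?y b"
        using xc v by (intro eq_vecI) (auto simp: algebra_simps)
      have "\<bar>(b - s) * t\<bar> \<le> \<bar>b - s\<bar> * (\<bar>t\<bar> + 1)" by (simp add: abs_mult distrib_left)
      also have "\<dots> < e" using b(3) by (simp add: pos_less_divide_eq add_nonneg_pos)
      finally show ?thesis using e(2)[of "(b - s) * t"] y[OF b(1,2)] by (simp add: eq)
    qed
    \<comment> \<open>Both endpoints are compared with \<open>s\<close>, and the two increments are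
      subtracted.\<close>
    have "P a b" if ab: "a \<le> s \<and> s \<le> b \<and> b - a < e / (\<bar>t\<bar> + 1)" for a b
      unfolding P_def
    proof (intro impI, elim conjE)
      assume "0 \<le> a" "b \<le> 1"
      then have "\<Psi> (?y a) = \<Psi> (?y s) + ((a - s) * t) \<cdot>\<^sub>v w"
        "\<Psi> (?y b) = \<Psi> (?y s) + ((b - s) * t) \<cdot>\<^sub>v w"
        using ab s by (auto intro!: near)
      then show "\<Psi> (?y b) = \<Psi> (?y a) + ((b - a) * t) \<cdot>\<^sub>v w"
        using \<Psi>y[OF s] w by (intro eq_vecI) (auto simp: algebra_simps)
    qed
    moreover have "e / (\<bar>t\<bar> + 1) > 0" using e by (simp add: add_nonneg_pos)
    ultimately show "\<exists>d>0. \<forall>a b. a \<le> s \<and> s \<le> b \<and> b - a < d \<longrightarrow> P a b" by blast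
  qed
  moreover have "?y 0 = x" "?y 1 = x + t \<cdot>\<^sub>v v" using xc v by (auto intro!: eq_vecI)
  ultimately show ?thesis by (simp add: P_def)
qed

section \<open>The subspace of affine directions\<close>

text \<open>A fixed embedding on a nonempty state space. Over an empty \<open>X\<close> every lifted
  vector would be an affine direction, and \<open>C\<close> could fail to be injective on
  them.\<close>

locale koopman_embedding =
  fixes n m nz :: nat and X U :: "real vec set" and f :: "real vec \<times> real vec \<Rightarrow> real vec"
    and \<Psi> :: "real vec \<Rightarrow> real vec" and A B C :: "real mat"
  assumes X_open: "open_Rn n X" and X_convex: "convex_Rn n X" and U_open: "open_Rn m U"
    and surj: "f ` (X \<times> U) = X" and X_nonempty: "X \<noteq> {}"
    and \<Psi>: "x \<in> X \<Longrightarrow> \<Psi> x \<in> carrier_vec nz"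
    and A: "A \<in> carrier_mat nz nz" and B: "B \<in> carrier_mat nz m" and C: "C \<in> carrier_mat n nz"
    and lift: "x \<in> X \<Longrightarrow> u \<in> U \<Longrightarrow> \<Psi> (f (x, u)) = A *\<^sub>v \<Psi> x + B *\<^sub>v u"
    and recover: "x \<in> X \<Longrightarrow> x = C *\<^sub>v \<Psi> x"
begin

lemma X_carrier: "x \<in> X \<Longrightarrow> x \<in> carrier_vec n" and U_carrier: "u \<in> U \<Longrightarrow> u \<in> carrier_vec m"
  using X_open U_open by (auto simp: open_Rn_def)

lemma f_mem: "x \<in> X \<Longrightarrow> u \<in> U \<Longrightarrow> f (x, u) \<in> X"
  using surj by blast

lemma surjE:
  assumes "y \<in> X" obtains x u where "x \<in> X" "u \<in> U" "y = f (x, u)"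
  using assms surj by blast

text \<open>The direction in the state space must be \<open>C *\<^sub>v w\<close>, because
  \<open>C\<close> recovers states from their lifts and so sends lifted displacements to
  displacements of states.\<close>

definition affine_dirs :: "real vec set" where
  "affine_dirs = {w \<in> carrier_vec nz.
     \<forall>x\<in>X. \<forall>t. x + t \<cdot>\<^sub>v (C *\<^sub>v w) \<in> X \<longrightarrow> \<Psi> (x + t \<cdot>\<^sub>v (C *\<^sub>v w)) = \<Psi> x + t \<cdot>\<^sub>v w}"

lemma affine_dirs_carrier: "w \<in> affine_dirs \<Longrightarrow> w \<in> carrier_vec nz"
  by (simp add: affine_dirs_def)

lemma affine_dirsD:
  "w \<in> affine_dirs \<Longrightarrow> x \<in> X \<Longrightarrow> x + t \<cdot>\<^sub>v (C *\<^sub>v w) \<in> X \<Longrightarrow>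
    \<Psi> (x + t \<cdot>\<^sub>v (C *\<^sub>v w)) = \<Psi> x + t \<cdot>\<^sub>v w"
  by (simp add: affine_dirs_def)

text \<open>Convexity of \<open>X\<close> makes the local condition global, so small perturbations
  of states and inputs suffice below.\<close>

lemma affine_dirsI:
  assumes w: "w \<in> carrier_vec nz"
    and "\<And>x. x \<in> X \<Longrightarrow> \<exists>e>0. \<forall>s. \<bar>s\<bar> < e \<longrightarrow> x + s \<cdot>\<^sub>v (C *\<^sub>v w) \<in> X \<longrightarrow>
      \<Psi> (x + s \<cdot>\<^sub>v (C *\<^sub>v w)) = \<Psi> x + s \<cdot>\<^sub>v w"
  shows "w \<in> affine_dirs"
  unfolding affine_dirs_def
  using locally_affine_on_line[OF X_convex _ _ w, of \<Psi> "C *\<^sub>v w"] assms \<Psi> C by auto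

lemma open_dir:
  assumes "x \<in> X" "w \<in> carrier_vec nz"
  shows "\<exists>e>0. \<forall>s. \<bar>s\<bar> < e \<longrightarrow> x + s \<cdot>\<^sub>v (C *\<^sub>v w) \<in> X"
  using open_Rn_line[OF X_open assms(1) mult_mat_vec_carrier[OF C assms(2)]] .

text \<open>Apply \<open>C\<close> to the lifted equation. This locates the image under
  \<open>f\<close> of a perturbed state or input, for which only the lift is known.\<close>

lemma displacement_eq:
  assumes y: "y \<in> X" and y': "y' \<in> X" and w: "w \<in> carrier_vec nz" and eq: "\<Psi> y' = \<Psi> y + s \<cdot>\<^sub>v w"
  shows "y' = y + s \<cdot>\<^sub>v (C *\<^sub>v w)"
proof -
  have "y' = C *\<^sub>v (\<Psi> y + s \<cdot>\<^sub>v w)" using recover[OF y'] eq by simp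
  also have "\<dots> = C *\<^sub>v \<Psi> y + s \<cdot>\<^sub>v (C *\<^sub>v w)"
    using mult_add_distrib_mat_vec[OF C \<Psi>[OF y]] mult_mat_vec[OF C w] w by simp
  finally show ?thesis using recover[OF y] by simp
qed

text \<open>By surjectivity any \<open>y\<close> is some \<open>f (x, u)\<close>. Moving
  \<open>x\<close> by \<open>s \<cdot>\<^sub>v (C *\<^sub>v w)\<close> moves the lift of the image
  by \<open>s \<cdot>\<^sub>v (A *\<^sub>v w)\<close>; the image stays in \<open>X\<close>, so it is
  the displaced point \<open>y + s \<cdot>\<^sub>v (C *\<^sub>v (A *\<^sub>v w))\<close>.\<close>

lemma affine_dirs_A:
  assumes w: "w \<in> affine_dirs"
  shows "A *\<^sub>v w \<in> affine_dirs"
proof (rule affine_dirsI)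
  note wc = affine_dirs_carrier[OF w]
  show Aw: "A *\<^sub>v w \<in> carrier_vec nz" using A wc by auto
  fix y assume y: "y \<in> X"
  then obtain x u where x: "x \<in> X" and u: "u \<in> U" and yx: "y = f (x, u)" by (rule surjE)
  obtain e where e: "e > 0" "\<And>s. \<bar>s\<bar> < e \<Longrightarrow> x + s \<cdot>\<^sub>v (C *\<^sub>v w) \<in> X"
    using open_dir[OF x wc] by blast
  have "\<Psi> (y + s \<cdot>\<^sub>v (C *\<^sub>v (A *\<^sub>v w))) = \<Psi> y + s \<cdot>\<^sub>v (A *\<^sub>v w)" if s: "\<bar>s\<bar> < e" for s
  proof -
    let ?x = "x + s \<cdot>\<^sub>v (C *\<^sub>v w)"
    note x' = e(2)[OF s]
    have "\<Psi> (f (?x, u)) = A *\<^sub>v (\<Psi> x + s \<cdot>\<^sub>v w) + B *\<^sub>v u"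
      using lift[OF x' u] affine_dirsD[OF w x x'] by simp
    also have "\<dots> = (A *\<^sub>v \<Psi> x + s \<cdot>\<^sub>v (A *\<^sub>v w)) + B *\<^sub>v u"
      using mult_add_distrib_mat_vec[OF A \<Psi>[OF x]] mult_mat_vec[OF A wc] wc by simp
    also have "\<dots> = (A *\<^sub>v \<Psi> x + B *\<^sub>v u) + s \<cdot>\<^sub>v (A *\<^sub>v w)"
      using A B by (intro eq_vecI) auto
    finally have "\<Psi> (f (?x, u)) = \<Psi> y + s \<cdot>\<^sub>v (A *\<^sub>v w)"
      using lift[OF x u] yx by simp
    then show ?thesis using displacement_eq[OF y f_mem[OF x' u] Aw] by simp
  qed
  then show "\<exists>e>0. \<forall>s. \<bar>s\<bar> < e \<longrightarrow> y + s \<cdot>\<^sub>v (C *\<^sub>v (A *\<^sub>v w)) \<in> X \<longrightarrow>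
      \<Psi> (y + s \<cdot>\<^sub>v (C *\<^sub>v (A *\<^sub>v w))) = \<Psi> y + s \<cdot>\<^sub>v (A *\<^sub>v w)"
    using e(1) by blast
qed

text \<open>Here the state is kept and the input is perturbed inside the open set
  \<open>U\<close>.\<close>

lemma affine_dirs_B:
  assumes d: "d \<in> carrier_vec m"
  shows "B *\<^sub>v d \<in> affine_dirs"
proof (rule affine_dirsI)
  show Bd: "B *\<^sub>v d \<in> carrier_vec nz" using B d by auto
  fix y assume y: "y \<in> X"
  then obtain x u where x: "x \<in> X" and u: "u \<in> U" and yx: "y = f (x, u)" by (rule surjE)
  obtain e where e: "e > 0" "\<And>s. \<bar>s\<bar> < e \<Longrightarrow> u + s \<cdot>\<^sub>v d \<in> U"
    using open_Rn_line[OF U_open u d] by blast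
  have "\<Psi> (y + s \<cdot>\<^sub>v (C *\<^sub>v (B *\<^sub>v d))) = \<Psi> y + s \<cdot>\<^sub>v (B *\<^sub>v d)" if s: "\<bar>s\<bar> < e" for s
  proof -
    note u' = e(2)[OF s]
    have "\<Psi> (f (x, u + s \<cdot>\<^sub>v d)) = A *\<^sub>v \<Psi> x + B *\<^sub>v (u + s \<cdot>\<^sub>v d)"
      using lift[OF x u'] .
    also have "\<dots> = A *\<^sub>v \<Psi> x + (B *\<^sub>v u + s \<cdot>\<^sub>v (B *\<^sub>v d))"
      using mult_add_distrib_mat_vec[OF B U_carrier[OF u]] mult_mat_vec[OF B d] d by simp
    also have "\<dots> = (A *\<^sub>v \<Psi> x + B *\<^sub>v u) + s \<cdot>\<^sub>v (B *\<^sub>v d)"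
      using A B by (intro eq_vecI) auto
    finally have "\<Psi> (f (x, u + s \<cdot>\<^sub>v d)) = \<Psi> y + s \<cdot>\<^sub>v (B *\<^sub>v d)"
      using lift[OF x u] yx by simp
    then show ?thesis using displacement_eq[OF y f_mem[OF x u'] Bd] by simp
  qed
  then show "\<exists>e>0. \<forall>s. \<bar>s\<bar> < e \<longrightarrow> y + s \<cdot>\<^sub>v (C *\<^sub>v (B *\<^sub>v d)) \<in> X \<longrightarrow>
      \<Psi> (y + s \<cdot>\<^sub>v (C *\<^sub>v (B *\<^sub>v d))) = \<Psi> y + s \<cdot>\<^sub>v (B *\<^sub>v d)"
    using e(1) by blast
qed

text \<open>Move along \<open>v\<close> first and then along \<open>w\<close>. Only for small
  \<open>s\<close> is the intermediate point sure to lie in \<open>X\<close>, so the local criterion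
  is used.\<close>

lemma affine_dirs_add:
  assumes v: "v \<in> affine_dirs" and w: "w \<in> affine_dirs"
  shows "v + w \<in> affine_dirs"
proof (rule affine_dirsI)
  note vc = affine_dirs_carrier[OF v] and wc = affine_dirs_carrier[OF w]
  show "v + w \<in> carrier_vec nz" using vc wc by simp
  fix x assume x: "x \<in> X"
  obtain e where e: "e > 0" "\<And>s. \<bar>s\<bar> < e \<Longrightarrow> x + s \<cdot>\<^sub>v (C *\<^sub>v v) \<in> X"
    using open_dir[OF x vc] by blast
  have "\<Psi> (x + s \<cdot>\<^sub>v (C *\<^sub>v (v + w))) = \<Psi> x + s \<cdot>\<^sub>v (v + w)"
    if s: "\<bar>s\<bar> < e" and mem: "x + s \<cdot>\<^sub>v (C *\<^sub>v (v + w)) \<in> X" for s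
  proof -
    let ?x = "x + s \<cdot>\<^sub>v (C *\<^sub>v v)"
    have eq: "x + s \<cdot>\<^sub>v (C *\<^sub>v (v + w)) = ?x + s \<cdot>\<^sub>v (C *\<^sub>v w)"
      unfolding mult_add_distrib_mat_vec[OF C vc wc]
      using C X_carrier[OF x] by (intro eq_vecI) (auto simp: algebra_simps)
    have "\<Psi> (x + s \<cdot>\<^sub>v (C *\<^sub>v (v + w))) = \<Psi> x + s \<cdot>\<^sub>v v + s \<cdot>\<^sub>v w"
      using affine_dirsD[OF w e(2)[OF s], of s] affine_dirsD[OF v x e(2)[OF s]] mem
      by (simp add: eq)
    also have "\<dots> = \<Psi> x + s \<cdot>\<^sub>v (v + w)"
      using vc wc \<Psi>[OF x] by (intro eq_vecI) (auto simp: algebra_simps)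
    finally show ?thesis .
  qed
  then show "\<exists>e>0. \<forall>s. \<bar>s\<bar> < e \<longrightarrow> x + s \<cdot>\<^sub>v (C *\<^sub>v (v + w)) \<in> X \<longrightarrow>
      \<Psi> (x + s \<cdot>\<^sub>v (C *\<^sub>v (v + w))) = \<Psi> x + s \<cdot>\<^sub>v (v + w)"
    using e(1) by blast
qed

lemma affine_dirs_smult:
  assumes w: "w \<in> affine_dirs"
  shows "c \<cdot>\<^sub>v w \<in> affine_dirs"
proof -
  note wc = affine_dirs_carrier[OF w]
  show ?thesis
    using affine_dirsD[OF w] wc
    by (simp add: affine_dirs_def mult_mat_vec[OF C wc] smult_smult_assoc)
qed

lemma affine_dirs_subspace: "vec_subspace nz affine_dirs"
proof -
  have "0\<^sub>v nz = B *\<^sub>v 0\<^sub>v m" using B by auto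
  then have "0\<^sub>v nz \<in> affine_dirs" using affine_dirs_B[of "0\<^sub>v m"] by simp
  then show ?thesis
    using affine_dirs_carrier affine_dirs_add affine_dirs_smult by (auto simp: vec_subspace_def)
qed

text \<open>The difference of \<open>v\<close> and \<open>w\<close> is an affine direction that
  displaces no state, hence adds nothing to the lift of any point of \<open>X\<close>.\<close>

lemma affine_dirs_inj:
  assumes v: "v \<in> affine_dirs" and w: "w \<in> affine_dirs" and eq: "C *\<^sub>v v = C *\<^sub>v w"
  shows "v = w"
proof -
  note vc = affine_dirs_carrier[OF v] and wc = affine_dirs_carrier[OF w]
  obtain x where x: "x \<in> X" using X_nonempty by blast
  let ?d = "v + (- 1) \<cdot>\<^sub>v w"
  have d: "?d \<in> affine_dirs" by (intro affine_dirs_add affine_dirs_smult v w)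
  have "C *\<^sub>v ?d = C *\<^sub>v w + (- 1) \<cdot>\<^sub>v (C *\<^sub>v w)"
    using mult_add_distrib_mat_vec[OF C vc] mult_mat_vec[OF C wc] wc eq by simp
  also have "\<dots> = 0\<^sub>v n" using C by (intro eq_vecI) auto
  finally have "x + 1 \<cdot>\<^sub>v (C *\<^sub>v ?d) = x" using X_carrier[OF x] by simp
  then have *: "\<Psi> x = \<Psi> x + 1 \<cdot>\<^sub>v ?d" using affine_dirsD[OF d x, of 1] x by simp
  have "v $ i = w $ i" if i: "i < nz" for i
  proof -
    have "\<Psi> x $ i = (\<Psi> x + 1 \<cdot>\<^sub>v ?d) $ i" using * by (rule arg_cong)
    also have "\<dots> = \<Psi> x $ i + (v $ i - w $ i)" using i vc wc by simp
    finally show ?thesis by simp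
  qed
  then show ?thesis using vc wc by (intro eq_vecI) auto
qed

section \<open>From affine directions to the CAP form\<close>

lemma image_affine_dirs_subspace: "vec_subspace n ((*\<^sub>v) C ` affine_dirs)"
  unfolding vec_subspace_def
proof (intro conjI ballI allI)
  show "(*\<^sub>v) C ` affine_dirs \<subseteq> carrier_vec n"
    using C affine_dirs_carrier by (auto intro: mult_mat_vec_carrier)
  have "C *\<^sub>v 0\<^sub>v nz = 0\<^sub>v n" using C by auto
  then show "0\<^sub>v n \<in> (*\<^sub>v) C ` affine_dirs"
    using affine_dirs_subspace by (metis image_eqI vec_subspace_def)
next
  fix v w assume "v \<in> (*\<^sub>v) C ` affine_dirs" "w \<in> (*\<^sub>v) C ` affine_dirs"
  then obtain a b where ab: "a \<in> affine_dirs" "b \<in> affine_dirs" "v = C *\<^sub>v a" "w = C *\<^sub>v b" by blast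
  then have "v + w = C *\<^sub>v (a + b)"
    using mult_add_distrib_mat_vec[OF C] affine_dirs_carrier by simp
  then show "v + w \<in> (*\<^sub>v) C ` affine_dirs" using ab affine_dirs_add by blast
next
  fix c v assume "v \<in> (*\<^sub>v) C ` affine_dirs"
  then obtain a where a: "a \<in> affine_dirs" "v = C *\<^sub>v a" by blast
  then have "c \<cdot>\<^sub>v v = C *\<^sub>v (c \<cdot>\<^sub>v a)" using mult_mat_vec[OF C] affine_dirs_carrier by simp
  then show "c \<cdot>\<^sub>v v \<in> (*\<^sub>v) C ` affine_dirs" using a affine_dirs_smult by blast
qed

text \<open>With \<open>x1\<close> and \<open>x2\<close> the blocks of \<open>T *\<^sub>v x\<close>,
  the lift splits as \<open>\<Psi> x = \<Psi>b x2 + L *\<^sub>v x1\<close>, the second summand being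
  an affine direction. The matrix \<open>A\<close> keeps that summand affine and the input adds
  another affine direction, so neither reaches \<open>C2\<close> or \<open>N\<close>.\<close>

lemma embedding_imp_cap:
  assumes nz: "nz > 0"
  shows "\<exists>T n1 n2 g h C' D. T \<in> carrier_mat n n \<and> invertible_mat T \<and> n1 + n2 = n \<and>
    cap_form n1 n2 m X U f T g h C' D \<and>
    koopman_closed_generator n1 n2 (proj_snd n1 n2 (mat_image T X)) g h"
proof -
  obtain S T n1 n2 where S: "S \<in> carrier_mat n n" and T: "T \<in> carrier_mat n n"
    and TS: "T * S = 1\<^sub>m n" and ST: "S * T = 1\<^sub>m n" and n12: "n1 + n2 = n"
    and cols: "\<forall>j<n1. col S j \<in> (*\<^sub>v) C ` affine_dirs"
    and last: "\<forall>v \<in> (*\<^sub>v) C ` affine_dirs. vec_last (T *\<^sub>v v) n2 = 0\<^sub>v n2"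
    by (rule subspace_coordinates[OF image_affine_dirs_subspace])
  have T_inj: "v = w" if "T *\<^sub>v v = T *\<^sub>v w" "v \<in> carrier_vec n" "w \<in> carrier_vec n" for v w
    using mult_mat_vec_inverse[OF S T ST that(2)] mult_mat_vec_inverse[OF S T ST that(3)]
    unfolding that(1) by (rule trans[OF sym])
  have "T * C \<in> carrier_mat (n1 + n2) nz" using T C n12 by simp
  then obtain C1 C2 where C1: "C1 \<in> carrier_mat n1 nz" and C2: "C2 \<in> carrier_mat n2 nz"
    and split: "\<forall>w\<in>carrier_vec nz. (T * C) *\<^sub>v w = (C1 *\<^sub>v w) @\<^sub>v (C2 *\<^sub>v w)"
    by (rule split_rows)
  have TC: "T *\<^sub>v (C *\<^sub>v w) = (C1 *\<^sub>v w) @\<^sub>v (C2 *\<^sub>v w)" if "w \<in> carrier_vec nz" for w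
    using split T C that by simp
  have C1c: "C1 *\<^sub>v w \<in> carrier_vec n1" and C2c: "C2 *\<^sub>v w \<in> carrier_vec n2"
    if "w \<in> carrier_vec nz" for w
    using C1 C2 that by auto
  have TX: "T *\<^sub>v x = (C1 *\<^sub>v \<Psi> x) @\<^sub>v (C2 *\<^sub>v \<Psi> x)" if "x \<in> X" for x
    using TC[OF \<Psi>[OF that]] recover[OF that] by simp

  \<comment> \<open>\<open>W j\<close> lifts the basis vector \<open>col S j\<close> to an affine
    direction. With these as columns, \<open>L\<close> sends the first block of coordinates into
    \<open>affine_dirs\<close>.\<close>
  define W where "W j = (SOME w. w \<in> affine_dirs \<and> C *\<^sub>v w = col S j)" for j
  have W: "W j \<in> affine_dirs" "C *\<^sub>v W j = col S j" if j: "j < n1" for j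
  proof -
    have "col S j \<in> (*\<^sub>v) C ` affine_dirs" using cols j by blast
    then have "\<exists>w. w \<in> affine_dirs \<and> C *\<^sub>v w = col S j" by (elim imageE) auto
    from someI_ex[OF this] show "W j \<in> affine_dirs" "C *\<^sub>v W j = col S j"
      by (simp_all add: W_def)
  qed
  define L where "L = mat nz n1 (\<lambda>(i, j). W j $ i)"
  have L: "L \<in> carrier_mat nz n1" by (simp add: L_def)
  have col_L: "col L j = W j" if "j < n1" for j
    using affine_dirs_carrier[OF W(1)[OF that]] that by (intro eq_vecI) (auto simp: L_def)
  have L_mem: "L *\<^sub>v a \<in> affine_dirs" if "a \<in> carrier_vec n1" for a
    using mult_mat_vec_mem_subspace[OF affine_dirs_subspace L _ that] col_L W(1) by simp
  have C2_zero: "C2 *\<^sub>v w = 0\<^sub>v n2" if w: "w \<in> affine_dirs" for w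
  proof -
    note wc = affine_dirs_carrier[OF w]
    have "vec_last ((C1 *\<^sub>v w) @\<^sub>v (C2 *\<^sub>v w)) n2 = 0\<^sub>v n2"
      using last w unfolding TC[OF wc, symmetric] by blast
    moreover have "vec_last ((C1 *\<^sub>v w) @\<^sub>v (C2 *\<^sub>v w)) n2 = C2 *\<^sub>v w"
      using vec_last_append[OF C1c[OF wc] C2c[OF wc]] .
    ultimately show ?thesis by simp
  qed
  have C1W: "C1 *\<^sub>v W j = unit_vec n1 j" if j: "j < n1" for j
  proof -
    note wc = affine_dirs_carrier[OF W(1)[OF j]]
    have "(C1 *\<^sub>v W j) @\<^sub>v (C2 *\<^sub>v W j) = T *\<^sub>v col S j" using TC[OF wc] W(2)[OF j] by simp
    also have "\<dots> = col (T * S) j" using col_mult2[OF T S, of j] j n12 by simp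
    also have "\<dots> = unit_vec n j" using TS j n12 by simp
    also have "\<dots> = unit_vec n1 j @\<^sub>v 0\<^sub>v n2"
      using j n12 by (intro eq_vecI) auto
    finally show ?thesis using append_vec_eq[OF C1c[OF wc] unit_vec_carrier[of n1 j]] by blast
  qed
  have C1L: "C1 *\<^sub>v (L *\<^sub>v a) = a" if a: "a \<in> carrier_vec n1" for a
  proof -
    have "C1 * L = 1\<^sub>m n1"
    proof (rule mat_col_eqI)
      fix j assume j: "j < dim_col (1\<^sub>m n1)"
      then have "col (C1 * L) j = C1 *\<^sub>v W j" using col_mult2[OF C1 L] col_L by simp
      then show "col (C1 * L) j = col (1\<^sub>m n1) j" using C1W j by simp
    qed (use C1 L in auto)
    then show ?thesis using mult_mat_vec_inverse[OF C1 L _ a] by simp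
  qed
  \<comment> \<open>Both sides are affine directions with the same blocks \<open>C1\<close> and
    \<open>C2\<close>, hence the same image under \<open>C\<close>, where injectivity
    applies.\<close>
  have LC1: "L *\<^sub>v (C1 *\<^sub>v w) = w" if w: "w \<in> affine_dirs" for w
  proof (rule affine_dirs_inj[OF L_mem w])
    note wc = affine_dirs_carrier[OF w]
    show c: "C1 *\<^sub>v w \<in> carrier_vec n1" using C1c[OF wc] .
    note l = L_mem[OF c]
    have "T *\<^sub>v (C *\<^sub>v (L *\<^sub>v (C1 *\<^sub>v w))) = T *\<^sub>v (C *\<^sub>v w)"
      using TC[OF affine_dirs_carrier[OF l]] TC[OF wc] C2_zero[OF l] C2_zero[OF w] C1L[OF c] by simp
    then show "C *\<^sub>v (L *\<^sub>v (C1 *\<^sub>v w)) = C *\<^sub>v w"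
      by (rule T_inj) (use C wc affine_dirs_carrier[OF l] in \<open>auto intro!: mult_mat_vec_carrier\<close>)
  qed

  \<comment> \<open>\<open>L * C1\<close> projects onto \<open>affine_dirs\<close>; \<open>N\<close>
    is the complementary projection.\<close>
  define N where "N = 1\<^sub>m nz - L * C1"
  have N: "N \<in> carrier_mat nz nz" using L C1 by (simp add: N_def minus_carrier_mat)
  have Nv: "N *\<^sub>v w = w - L *\<^sub>v (C1 *\<^sub>v w)" if w: "w \<in> carrier_vec nz" for w
    using minus_mult_distrib_mat_vec[OF one_carrier_mat _ w, of "L * C1"] L C1 w by (simp add: N_def)
  have N_zero: "N *\<^sub>v w = 0\<^sub>v nz" if "w \<in> affine_dirs" for w
    using Nv LC1[OF that] affine_dirs_carrier[OF that] by simp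
  \<comment> \<open>Two states with the same second block differ by \<open>C *\<^sub>v w\<close>,
    where \<open>w\<close> is the image under \<open>L\<close> of the difference of their first
    blocks. Their lifts then differ by the affine direction \<open>w\<close>, which \<open>N\<close>
    kills.\<close>
  have fibre: "N *\<^sub>v \<Psi> x' = N *\<^sub>v \<Psi> x"
    if x: "x \<in> X" and x': "x' \<in> X" and eq: "C2 *\<^sub>v \<Psi> x' = C2 *\<^sub>v \<Psi> x" for x x'
  proof -
    note z = \<Psi>[OF x] and z' = \<Psi>[OF x']
    define a where "a = C1 *\<^sub>v \<Psi> x' - C1 *\<^sub>v \<Psi> x"
    define w where "w = L *\<^sub>v a"
    have a: "a \<in> carrier_vec n1" using C1c[OF z] C1c[OF z'] by (simp add: a_def)
    have w: "w \<in> affine_dirs" using L_mem[OF a] by (simp add: w_def)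
    note wc = affine_dirs_carrier[OF w]
    have Cw: "C *\<^sub>v w \<in> carrier_vec n" using C wc by auto
    have "T *\<^sub>v (x + C *\<^sub>v w) = T *\<^sub>v x + T *\<^sub>v (C *\<^sub>v w)"
      using mult_add_distrib_mat_vec[OF T X_carrier[OF x] Cw] .
    also have "\<dots> = ((C1 *\<^sub>v \<Psi> x) @\<^sub>v (C2 *\<^sub>v \<Psi> x)) + (a @\<^sub>v 0\<^sub>v n2)"
      using TX[OF x] TC[OF wc] C1L[OF a] C2_zero[OF w] by (simp add: w_def)
    also have "\<dots> = (C1 *\<^sub>v \<Psi> x + a) @\<^sub>v (C2 *\<^sub>v \<Psi> x + 0\<^sub>v n2)"
      using append_vec_add[OF C1c[OF z] a C2c[OF z] zero_carrier_vec] .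
    also have "C1 *\<^sub>v \<Psi> x + a = C1 *\<^sub>v \<Psi> x'"
      using C1c[OF z] C1c[OF z'] by (intro eq_vecI) (auto simp: a_def)
    also have "C2 *\<^sub>v \<Psi> x + 0\<^sub>v n2 = C2 *\<^sub>v \<Psi> x'" using C2c[OF z] eq by simp
    finally have "x + C *\<^sub>v w = x'"
      using TX[OF x'] X_carrier[OF x] X_carrier[OF x'] Cw by (intro T_inj[of "x + C *\<^sub>v w" x']) auto
    then have "\<Psi> x' = \<Psi> x + w"
      using affine_dirsD[OF w x, of 1] x' by simp
    then have "N *\<^sub>v \<Psi> x' = N *\<^sub>v \<Psi> x + N *\<^sub>v w"
      using mult_add_distrib_mat_vec[OF N z wc] by simp
    then show ?thesis using N_zero[OF w] N z by simp
  qed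
  \<comment> \<open>By \<open>fibre\<close> the value does not depend on the chosen state.\<close>
  define \<Psi>b where "\<Psi>b x2 = N *\<^sub>v \<Psi> (SOME x. x \<in> X \<and> C2 *\<^sub>v \<Psi> x = x2)" for x2
  have \<Psi>b: "\<Psi>b (C2 *\<^sub>v \<Psi> x) = N *\<^sub>v \<Psi> x" if x: "x \<in> X" for x
  proof -
    let ?Q = "\<lambda>y. y \<in> X \<and> C2 *\<^sub>v \<Psi> y = C2 *\<^sub>v \<Psi> x"
    have "?Q (Eps ?Q)" by (rule someI[of ?Q x]) (use x in simp)
    then show ?thesis using fibre[OF x] unfolding \<Psi>b_def by blast
  qed
  define g where "g x2 = C1 *\<^sub>v (A *\<^sub>v \<Psi>b x2)" for x2
  define h where "h x2 = C2 *\<^sub>v (A *\<^sub>v \<Psi>b x2)" for x2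
  define P where "P = proj_snd n1 n2 (mat_image T X)"
  have P: "\<exists>x\<in>X. x2 = C2 *\<^sub>v \<Psi> x" if x2: "x2 \<in> P" for x2
  proof -
    obtain x x1 where x: "x \<in> X" and x1: "x1 \<in> carrier_vec n1" "x1 @\<^sub>v x2 = T *\<^sub>v x"
      using x2 unfolding P_def proj_snd_def mat_image_def by blast
    then have "x1 @\<^sub>v x2 = (C1 *\<^sub>v \<Psi> x) @\<^sub>v (C2 *\<^sub>v \<Psi> x)" using TX by simp
    then show ?thesis using x append_vec_eq[OF x1(1) C1c[OF \<Psi>[OF x]]] by blast
  qed
  \<comment> \<open>\<open>r\<close> collects the affine part of the next lift: the contributions of
    \<open>x1\<close> and of the input.\<close>
  have step: "\<exists>r\<in>affine_dirs. r = A *\<^sub>v (L *\<^sub>v (C1 *\<^sub>v \<Psi> x)) + B *\<^sub>v u \<and>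
      \<Psi> (f (x, u)) = A *\<^sub>v \<Psi>b (C2 *\<^sub>v \<Psi> x) + r" if x: "x \<in> X" and u: "u \<in> U" for x u
  proof -
    note z = \<Psi>[OF x]
    let ?l = "L *\<^sub>v (C1 *\<^sub>v \<Psi> x)" and ?b = "\<Psi>b (C2 *\<^sub>v \<Psi> x)"
    have l: "?l \<in> affine_dirs" using L_mem[OF C1c[OF z]] .
    note lc = affine_dirs_carrier[OF l]
    have b: "?b \<in> carrier_vec nz" using \<Psi>b[OF x] N z by auto
    have "\<Psi> x = ?b + ?l"
      unfolding \<Psi>b[OF x] Nv[OF z] using z L by (intro eq_vecI) auto
    then have "\<Psi> (f (x, u)) = A *\<^sub>v (?b + ?l) + B *\<^sub>v u" using lift[OF x u] by simp
    also have "\<dots> = A *\<^sub>v ?b + A *\<^sub>v ?l + B *\<^sub>v u" using mult_add_distrib_mat_vec[OF A b lc] by simp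
    also have "\<dots> = A *\<^sub>v ?b + (A *\<^sub>v ?l + B *\<^sub>v u)"
      using A B by (intro eq_vecI) auto
    finally show ?thesis
      using affine_dirs_add[OF affine_dirs_A[OF l] affine_dirs_B[OF U_carrier[OF u]]] by blast
  qed
  have bc: "\<Psi>b (C2 *\<^sub>v \<Psi> x) \<in> carrier_vec nz" "A *\<^sub>v \<Psi>b (C2 *\<^sub>v \<Psi> x) \<in> carrier_vec nz"
    if "x \<in> X" for x
    using \<Psi>b[OF that] N A \<Psi>[OF that] by auto
  \<comment> \<open>\<open>C2\<close> kills \<open>r\<close>, so the second block of the next state
    depends on \<open>x2\<close> alone.\<close>
  have h_step: "h (C2 *\<^sub>v \<Psi> x) = C2 *\<^sub>v \<Psi> (f (x, u))" if x: "x \<in> X" and u: "u \<in> U" for x u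
  proof -
    obtain r where r: "r \<in> affine_dirs" "\<Psi> (f (x, u)) = A *\<^sub>v \<Psi>b (C2 *\<^sub>v \<Psi> x) + r"
      using step[OF x u] by blast
    then have "C2 *\<^sub>v \<Psi> (f (x, u)) = C2 *\<^sub>v (A *\<^sub>v \<Psi>b (C2 *\<^sub>v \<Psi> x)) + 0\<^sub>v n2"
      using mult_add_distrib_mat_vec[OF C2 bc(2)[OF x]] affine_dirs_carrier[OF r(1)] C2_zero[OF r(1)]
      by simp
    then show ?thesis using C2c[OF bc(2)[OF x]] by (simp add: h_def)
  qed

  \<comment> \<open>The matrices come from applying \<open>C1\<close> to
    \<open>r = A *\<^sub>v (L *\<^sub>v x1) + B *\<^sub>v u\<close>.\<close>
  have "cap_form n1 n2 m X U f T g h (C1 * A * L) (C1 * B)"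
    unfolding cap_form_def P_def[symmetric]
  proof (intro conjI ballI impI)
    show "g \<in> P \<rightarrow> carrier_vec n1" "h \<in> P \<rightarrow> carrier_vec n2"
      using P C1c C2c bc(2) by (fastforce simp: g_def h_def)+
    show "C1 * A * L \<in> carrier_mat n1 n1" "C1 * B \<in> carrier_mat n1 m" using C1 A B L by auto
  next
    fix x u x1 x2
    assume x: "x \<in> X" and u: "u \<in> U" and x1: "x1 \<in> carrier_vec n1" and x2: "x2 \<in> carrier_vec n2"
      and Tx: "T *\<^sub>v x = x1 @\<^sub>v x2"
    have "x1 @\<^sub>v x2 = (C1 *\<^sub>v \<Psi> x) @\<^sub>v (C2 *\<^sub>v \<Psi> x)" using TX[OF x] Tx by simp
    then have x12: "x1 = C1 *\<^sub>v \<Psi> x" "x2 = C2 *\<^sub>v \<Psi> x"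
      using append_vec_eq[OF x1 C1c[OF \<Psi>[OF x]]] by blast+
    note uc = U_carrier[OF u]
    let ?l = "L *\<^sub>v x1"
    have lc: "?l \<in> carrier_vec nz" using affine_dirs_carrier[OF L_mem[OF x1]] .
    obtain r where r: "r \<in> affine_dirs" "r = A *\<^sub>v ?l + B *\<^sub>v u" "\<Psi> (f (x, u)) = A *\<^sub>v \<Psi>b x2 + r"
      using step[OF x u] x12 by blast
    have c: "A *\<^sub>v ?l \<in> carrier_vec nz" "B *\<^sub>v u \<in> carrier_vec nz" using A B lc uc by auto
    have "C1 *\<^sub>v \<Psi> (f (x, u)) = g x2 + C1 *\<^sub>v r"
      using mult_add_distrib_mat_vec[OF C1 bc(2)[OF x] affine_dirs_carrier[OF r(1)]] r(3)
      by (simp add: g_def x12)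
    also have "C1 *\<^sub>v r = (C1 * A * L) *\<^sub>v x1 + (C1 * B) *\<^sub>v u"
      using mult_add_distrib_mat_vec[OF C1 c] r(2) C1 A B L x1 uc lc
        assoc_mult_mat_vec[of "C1 * A" n1 nz L n1 x1]
      by simp
    finally have 1: "C1 *\<^sub>v \<Psi> (f (x, u)) = g x2 + ((C1 * A * L) *\<^sub>v x1 + (C1 * B) *\<^sub>v u)" .
    have gc: "g x2 \<in> carrier_vec n1" and hc: "h x2 \<in> carrier_vec n2"
      using C1c C2c bc(2)[OF x] by (auto simp: g_def h_def x12)
    have Dc: "C1 * B \<in> carrier_mat n1 m" and Cx: "(C1 * A * L) *\<^sub>v x1 \<in> carrier_vec n1"
      and Du: "(C1 * B) *\<^sub>v u \<in> carrier_vec n1"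
      using C1 A B L x1 uc by (auto intro!: mult_mat_vec_carrier)
    have "T *\<^sub>v f (x, u) = (g x2 + ((C1 * A * L) *\<^sub>v x1 + (C1 * B) *\<^sub>v u)) @\<^sub>v h x2"
      using TX[OF f_mem[OF x u]] 1 h_step[OF x u] x12 by simp
    also have "\<dots> = ((g x2 + (C1 * A * L) *\<^sub>v x1) + (C1 * B) *\<^sub>v u) @\<^sub>v (h x2 + 0\<^sub>v n2)"
      using gc hc Cx Du by (simp add: assoc_add_vec)
    also have "\<dots> = ((g x2 + (C1 * A * L) *\<^sub>v x1) @\<^sub>v h x2) + (((C1 * B) *\<^sub>v u) @\<^sub>v 0\<^sub>v n2)"
      using append_vec_add[OF add_carrier_vec[OF gc Cx] Du hc zero_carrier_vec[of n2]] by simp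
    also have "((C1 * B) *\<^sub>v u) @\<^sub>v 0\<^sub>v n2 = ((C1 * B) @\<^sub>r 0\<^sub>m n2 m) *\<^sub>v u"
      using mat_mult_append[OF Dc zero_carrier_mat[of n2 m] uc] uc by (simp add: zero_mult_mat_vec)
    finally show "T *\<^sub>v f (x, u) =
        ((g x2 + (C1 * A * L) *\<^sub>v x1) @\<^sub>v h x2) + ((C1 * B) @\<^sub>r 0\<^sub>m n2 m) *\<^sub>v u" .
  qed
  moreover have "koopman_closed_generator n1 n2 P g h"
    unfolding koopman_closed_generator_def
  \<comment> \<open>\<open>N\<close> removes \<open>r\<close> from the next lift, leaving
    \<open>N * A\<close>. In the output matrix, \<open>C2\<close> returns \<open>x2\<close> because
    it vanishes on the part removed by \<open>N\<close>, and \<open>C1 * A\<close> is the definition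
    of \<open>g\<close>.\<close>
  proof (rule exI[of _ nz], rule exI[of _ \<Psi>b], rule exI[of _ "N * A"],
      rule exI[of _ "C2 @\<^sub>r (C1 * A)"], intro conjI ballI)
    show "nz > 0" by fact
    show "\<Psi>b \<in> P \<rightarrow> carrier_vec nz" using P bc(1) by fastforce
    show "N * A \<in> carrier_mat nz nz" "C2 @\<^sub>r (C1 * A) \<in> carrier_mat (n2 + n1) nz"
      using N A C1 C2 by auto
  next
    fix x2 assume "x2 \<in> P"
    then obtain x where x: "x \<in> X" and x2: "x2 = C2 *\<^sub>v \<Psi> x" using P by blast
    \<comment> \<open>Some input exists by surjectivity; it exhibits \<open>h x2\<close> as the
      second block of an actual state, where \<open>\<Psi>b\<close> can be evaluated.\<close>
    obtain u where u: "u \<in> U" using surjE[OF x] by blast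
    obtain r where r: "r \<in> affine_dirs" "\<Psi> (f (x, u)) = A *\<^sub>v \<Psi>b x2 + r"
      using step[OF x u] x2 by blast
    have "\<Psi>b (h x2) = N *\<^sub>v \<Psi> (f (x, u))" using h_step[OF x u] \<Psi>b[OF f_mem[OF x u]] x2 by simp
    also have "\<dots> = N *\<^sub>v (A *\<^sub>v \<Psi>b x2) + N *\<^sub>v r"
      using mult_add_distrib_mat_vec[OF N bc(2)[OF x] affine_dirs_carrier[OF r(1)]] r(2) x2 by simp
    also have "\<dots> = (N * A) *\<^sub>v \<Psi>b x2"
      using N_zero[OF r(1)] N A bc[OF x] x2 by simp
    finally show "\<Psi>b (h x2) = (N * A) *\<^sub>v \<Psi>b x2" .
  next
    fix x2 assume "x2 \<in> P"
    then obtain x where x: "x \<in> X" and x2: "x2 = C2 *\<^sub>v \<Psi> x" using P by blast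
    note z = \<Psi>[OF x]
    have l: "L *\<^sub>v (C1 *\<^sub>v \<Psi> x) \<in> affine_dirs" using L_mem[OF C1c[OF z]] .
    have "C2 *\<^sub>v \<Psi>b x2 = C2 *\<^sub>v \<Psi> x - C2 *\<^sub>v (L *\<^sub>v (C1 *\<^sub>v \<Psi> x))"
      using mult_minus_distrib_mat_vec[OF C2 z affine_dirs_carrier[OF l]] \<Psi>b[OF x] Nv[OF z] x2 by simp
    also have "\<dots> = x2" using C2_zero[OF l] C2c[OF z] x2 by simp
    finally have 2: "C2 *\<^sub>v \<Psi>b x2 = x2" .
    have C1A: "C1 * A \<in> carrier_mat n1 nz" using C1 A by simp
    show "x2 @\<^sub>v g x2 = (C2 @\<^sub>r (C1 * A)) *\<^sub>v \<Psi>b x2"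
      using mat_mult_append[OF C2 C1A bc(1)[OF x]] 2 C1 A bc(1)[OF x] by (simp add: g_def x2)
  qed
  moreover have "invertible_mat T"
    using S T ST TS by (auto simp: invertible_mat_def inverts_mat_def)
  ultimately show ?thesis using T n12 unfolding P_def by blast
qed

end

section \<open>The equivalence\<close>

text \<open>The lift stacks \<open>x1\<close> over \<open>\<Psi>b x2\<close>. The generator makes
  \<open>g x2\<close> a linear function of \<open>\<Psi>b x2\<close>, so the nonlinearity in the
  first block becomes linear, and \<open>x2\<close> is recovered linearly as well.\<close>

lemma cap_imp_embedding:
  assumes X: "X \<subseteq> carrier_vec n" and U: "U \<subseteq> carrier_vec m" and f: "f ` (X \<times> U) = X"
    and T: "T \<in> carrier_mat n n" and inv: "invertible_mat T" and n12: "n1 + n2 = n"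
    and cap: "cap_form n1 n2 m X U f T g h C D"
    and gen: "koopman_closed_generator n1 n2 (proj_snd n1 n2 (mat_image T X)) g h"
  shows "koopman_linear_embedding n m X U f"
proof -
  define P where "P = proj_snd n1 n2 (mat_image T X)"
  obtain k \<Psi>b Ab Cb where k: "k > 0" and \<Psi>b: "\<Psi>b \<in> P \<rightarrow> carrier_vec k"
    and Ab: "Ab \<in> carrier_mat k k" and Cb: "Cb \<in> carrier_mat (n2 + n1) k"
    and closed: "\<And>x2. x2 \<in> P \<Longrightarrow> \<Psi>b (h x2) = Ab *\<^sub>v \<Psi>b x2 \<and> x2 @\<^sub>v g x2 = Cb *\<^sub>v \<Psi>b x2"
    using gen unfolding koopman_closed_generator_def P_def by blast
  \<comment> \<open>The output lists \<open>x2\<close> before \<open>g x2\<close>: \<open>H\<close>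
    recovers the former, \<open>G\<close> the latter.\<close>
  obtain H G where H: "H \<in> carrier_mat n2 k" and G: "G \<in> carrier_mat n1 k"
    and HG: "\<forall>w\<in>carrier_vec k. Cb *\<^sub>v w = (H *\<^sub>v w) @\<^sub>v (G *\<^sub>v w)"
    by (rule split_rows[OF Cb])
  obtain S where ST: "S * T = 1\<^sub>m n" and S: "S \<in> carrier_mat n n"
    using inv T unfolding invertible_mat_def inverts_mat_def
    by (metis carrier_matD carrier_matI index_mult_mat(2,3) index_one_mat(2,3))
  have gP: "g \<in> P \<rightarrow> carrier_vec n1" and hP: "h \<in> P \<rightarrow> carrier_vec n2"
    and C: "C \<in> carrier_mat n1 n1" and D: "D \<in> carrier_mat n1 m"
    and dyn: "\<And>x u x1 x2. x \<in> X \<Longrightarrow> u \<in> U \<Longrightarrow> x1 \<in> carrier_vec n1 \<Longrightarrow> x2 \<in> carrier_vec n2 \<Longrightarrow>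
      T *\<^sub>v x = x1 @\<^sub>v x2 \<Longrightarrow>
      T *\<^sub>v f (x, u) = ((g x2 + C *\<^sub>v x1) @\<^sub>v h x2) + (D @\<^sub>r 0\<^sub>m n2 m) *\<^sub>v u"
    using cap unfolding cap_form_def P_def by blast+
  define p where "p x = vec_first (T *\<^sub>v x) n1" for x
  define q where "q x = vec_last (T *\<^sub>v x) n2" for x
  have p: "p x \<in> carrier_vec n1" and q: "q x \<in> carrier_vec n2" for x
    by (simp_all add: p_def q_def)
  have pq: "T *\<^sub>v x = p x @\<^sub>v q x" if "x \<in> X" for x
  proof -
    have "T *\<^sub>v x \<in> carrier_vec (n1 + n2)" using T X n12 that by auto
    then show ?thesis by (simp add: p_def q_def)
  qed
  have qP: "q x \<in> P" if "x \<in> X" for x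
  proof -
    have "p x @\<^sub>v q x \<in> mat_image T X" unfolding mat_image_def pq[OF that, symmetric] using that by blast
    then show ?thesis unfolding P_def proj_snd_def using p q by blast
  qed
  have \<Psi>q: "\<Psi>b (q x) \<in> carrier_vec k" if "x \<in> X" for x using qP[OF that] \<Psi>b by auto
  have HGq: "H *\<^sub>v \<Psi>b (q x) = q x" "G *\<^sub>v \<Psi>b (q x) = g (q x)" if x: "x \<in> X" for x
  proof -
    have "(H *\<^sub>v \<Psi>b (q x)) @\<^sub>v (G *\<^sub>v \<Psi>b (q x)) = q x @\<^sub>v g (q x)"
      using closed[OF qP[OF x]] HG \<Psi>q[OF x] by simp
    then show "H *\<^sub>v \<Psi>b (q x) = q x" "G *\<^sub>v \<Psi>b (q x) = g (q x)"
      using append_vec_eq[of "H *\<^sub>v \<Psi>b (q x)" n2 "q x"] H q \<Psi>q[OF x] by auto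
  qed
  have next_state: "p (f (x, u)) = g (q x) + C *\<^sub>v p x + D *\<^sub>v u" "q (f (x, u)) = h (q x)"
    if x: "x \<in> X" and u: "u \<in> U" for x u
  proof -
    have fx: "f (x, u) \<in> X" using f x u by blast
    have uc: "u \<in> carrier_vec m" using U u by blast
    have gc: "g (q x) \<in> carrier_vec n1" and hc: "h (q x) \<in> carrier_vec n2"
      using gP hP qP[OF x] by auto
    have Cp: "C *\<^sub>v p x \<in> carrier_vec n1" and Du: "D *\<^sub>v u \<in> carrier_vec n1"
      using C D p uc by (auto intro!: mult_mat_vec_carrier)
    have "p (f (x, u)) @\<^sub>v q (f (x, u)) = ((g (q x) + C *\<^sub>v p x) @\<^sub>v h (q x)) + (D @\<^sub>r 0\<^sub>m n2 m) *\<^sub>v u"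
      using dyn[OF x u p q pq[OF x]] pq[OF fx] by simp
    also have "(D @\<^sub>r 0\<^sub>m n2 m) *\<^sub>v u = (D *\<^sub>v u) @\<^sub>v 0\<^sub>v n2"
      using mat_mult_append[OF D zero_carrier_mat[of n2 m] uc] uc by (simp add: zero_mult_mat_vec)
    also have "((g (q x) + C *\<^sub>v p x) @\<^sub>v h (q x)) + ((D *\<^sub>v u) @\<^sub>v 0\<^sub>v n2) =
        (g (q x) + C *\<^sub>v p x + D *\<^sub>v u) @\<^sub>v h (q x)"
      using append_vec_add[OF add_carrier_vec[OF gc Cp] Du hc zero_carrier_vec[of n2]] hc by simp
    finally have "p (f (x, u)) @\<^sub>v q (f (x, u)) = (g (q x) + C *\<^sub>v p x + D *\<^sub>v u) @\<^sub>v h (q x)" .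
    then show "p (f (x, u)) = g (q x) + C *\<^sub>v p x + D *\<^sub>v u" "q (f (x, u)) = h (q x)"
      using append_vec_eq[OF p[of "f (x, u)"] add_carrier_vec[OF add_carrier_vec[OF gc Cp] Du]] by auto
  qed
  let ?\<Psi> = "\<lambda>x. p x @\<^sub>v \<Psi>b (q x)"
  \<comment> \<open>The upper row of \<open>?A\<close> is the \<open>x1\<close> dynamics with
    \<open>g\<close> replaced by \<open>G\<close>, the lower row the autonomous lift.
    \<open>?E\<close> maps the lift to \<open>T *\<^sub>v x\<close>, and \<open>S\<close> undoes
    \<open>T\<close>.\<close>
  let ?A = "four_block_mat C G (0\<^sub>m k n1) Ab"
  let ?B = "D @\<^sub>r 0\<^sub>m k m"
  let ?E = "four_block_mat (1\<^sub>m n1) (0\<^sub>m n1 k) (0\<^sub>m n2 n1) H"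
  show ?thesis
    unfolding koopman_linear_embedding_def
  proof (rule exI[of _ "n1 + k"], rule exI[of _ ?\<Psi>], rule exI[of _ ?A], rule exI[of _ ?B],
      rule exI[of _ "S * ?E"], intro conjI ballI)
    show "0 < n1 + k" using k by simp
    show "?\<Psi> \<in> X \<rightarrow> carrier_vec (n1 + k)" using p \<Psi>q by auto
    show "?A \<in> carrier_mat (n1 + k) (n1 + k)" using C Ab by simp
    show "?B \<in> carrier_mat (n1 + k) m" using D by auto
    have "?E \<in> carrier_mat n (n1 + k)" using H n12 by auto
    then show "S * ?E \<in> carrier_mat n (n1 + k)" using S by (rule mult_carrier_mat[rotated])
  next
    fix x u assume x: "x \<in> X" and u: "u \<in> U"
    have uc: "u \<in> carrier_vec m" using U u by blast
    note \<Psi>c = \<Psi>q[OF x]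
    have gc: "g (q x) \<in> carrier_vec n1" using gP qP[OF x] by auto
    have Cp: "C *\<^sub>v p x \<in> carrier_vec n1" and Du: "D *\<^sub>v u \<in> carrier_vec n1"
      and Ac: "Ab *\<^sub>v \<Psi>b (q x) \<in> carrier_vec k"
      using C D p uc Ab \<Psi>c by (auto intro!: mult_mat_vec_carrier)
    have "?A *\<^sub>v ?\<Psi> x + ?B *\<^sub>v u =
        ((C *\<^sub>v p x + g (q x)) @\<^sub>v (Ab *\<^sub>v \<Psi>b (q x))) + ((D *\<^sub>v u) @\<^sub>v 0\<^sub>v k)"
      using four_block_mat_mult_vec[OF C G zero_carrier_mat Ab p \<Psi>c] HGq(2)[OF x]
        mat_mult_append[OF D zero_carrier_mat[of k m] uc] uc p Ac
      by (simp add: zero_mult_mat_vec)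
    also have "\<dots> = (C *\<^sub>v p x + g (q x) + D *\<^sub>v u) @\<^sub>v (Ab *\<^sub>v \<Psi>b (q x))"
      using append_vec_add[OF add_carrier_vec[OF Cp gc] Du Ac zero_carrier_vec[of k]] Ac by simp
    also have "C *\<^sub>v p x + g (q x) = g (q x) + C *\<^sub>v p x"
      using comm_add_vec[OF Cp gc] .
    finally show "?\<Psi> (f (x, u)) = ?A *\<^sub>v ?\<Psi> x + ?B *\<^sub>v u"
      using next_state[OF x u] closed[OF qP[OF x]] by simp
  next
    fix x u assume x: "x \<in> X" and u: "u \<in> U"
    note \<Psi>c = \<Psi>q[OF x]
    have E: "?E \<in> carrier_mat n (n1 + k)" using H n12 by auto
    have "?E *\<^sub>v ?\<Psi> x = T *\<^sub>v x"
      using four_block_mat_mult_vec[OF one_carrier_mat zero_carrier_mat zero_carrier_mat H p \<Psi>c]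
        HGq(1)[OF x] p q pq[OF x] \<Psi>c by (simp add: zero_mult_mat_vec)
    then have "(S * ?E) *\<^sub>v ?\<Psi> x = S *\<^sub>v (T *\<^sub>v x)"
      using assoc_mult_mat_vec[OF S E append_carrier_vec[OF p \<Psi>c]] by simp
    also have "\<dots> = x" using mult_mat_vec_inverse[OF S T ST] X x by blast
    finally show "x = (S * ?E) *\<^sub>v ?\<Psi> x" by simp
  qed
qed

theorem theorem2:
  fixes n m :: nat
    and X U :: "real vec set"
    and f :: "real vec \<times> real vec \<Rightarrow> real vec"
  assumes "open_Rn n X" and "convex_Rn n X"
    and "open_Rn m U"
    and "f ` (X \<times> U) = X"
  shows "koopman_linear_embedding n m X U f \<longleftrightarrow>
    (\<exists>T n1 n2 g h C D.
       T \<in> carrier_mat n n \<and> invertible_mat T \<and> n1 + n2 = n \<and>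
       cap_form n1 n2 m X U f T g h C D \<and>
       koopman_closed_generator n1 n2 (proj_snd n1 n2 (mat_image T X)) g h)"
    (is "?emb \<longleftrightarrow> ?cap")
proof
  assume emb: ?emb
  show ?cap
  \<comment> \<open>The locale needs a point of \<open>X\<close>. For empty \<open>X\<close> the
    projection is empty too, so with \<open>n1 = 0\<close> any \<open>g\<close> and \<open>h\<close>
    do; the lifting dimension 1 is there to be positive.\<close>
  proof (cases "X = {}")
    case True
    have inv: "invertible_mat (1\<^sub>m n :: real mat)"
      by (auto simp: invertible_mat_def inverts_mat_def intro!: exI[of _ "1\<^sub>m n"])
    have empty: "proj_snd 0 n (mat_image (1\<^sub>m n) X) = {}"
      using True by (simp add: proj_snd_def mat_image_def)
    have "cap_form 0 n m X U f (1\<^sub>m n) g h (0\<^sub>m 0 0) (0\<^sub>m 0 m)" for g h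
      using True empty by (simp add: cap_form_def)
    moreover have "koopman_closed_generator 0 n {} g h" for g h
      unfolding koopman_closed_generator_def
      by (rule exI[of _ 1], rule exI[of _ "\<lambda>_. 0\<^sub>v 1"], rule exI[of _ "0\<^sub>m 1 1"],
          rule exI[of _ "0\<^sub>m (n + 0) 1"]) simp
    ultimately show ?thesis using inv empty
      by (metis (no_types, lifting) add_0 one_carrier_mat)
  next
    case False
    obtain nz \<Psi> A B C where "nz > 0" and
      "\<Psi> \<in> X \<rightarrow> carrier_vec nz" "A \<in> carrier_mat nz nz" "B \<in> carrier_mat nz m" "C \<in> carrier_mat n nz"
      "\<forall>x\<in>X. \<forall>u\<in>U. \<Psi> (f (x, u)) = A *\<^sub>v \<Psi> x + B *\<^sub>v u \<and> x = C *\<^sub>v \<Psi> x"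
      using emb unfolding koopman_linear_embedding_def by blast
    then interpret koopman_embedding n m nz X U f \<Psi> A B C
      by unfold_locales (use assms False in auto)
    show ?thesis using embedding_imp_cap \<open>nz > 0\<close> .
  qed
next
  assume ?cap
  then show ?emb
    using cap_imp_embedding assms unfolding open_Rn_def by blast
qed

end
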